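(* Let $\varphi:\mathbb{D}\to\mathbb{C}$ be a conformal and $c$-linearly connected mapping defined in $\mathbb{D}$. Then, for every $a\in\mathbb{D}$, the function $$\varphi_a(z)=\frac{\varphi\left(\frac{z+a}{1+\overline{a}z}\right)-\varphi(a)}{(1-|a|^2)\varphi'(a)},\qquad z\in\mathbb{D},$$ is a $c$-linearly connected mapping.
   Context: $\mathbb{D}=\{z\in\mathbb{C}:|z|<1\}$. Conformal means analytic and injective. For a constant $c\ge1$, a conformal mapping $\varphi$ of $\mathbb{D}$ is called $c$-linearly connected if for any $z_1,z_2\in\mathbb{D}$ there exists a curve $\gamma\subset\varphi(\mathbb{D})$ joining $\varphi(z_1)$ to $\varphi(z_2)$ whose length satisfies $\ell_\gamma\le c\,|\varphi(z_1)-\varphi(z_2)|$. *)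

theory Defs
  imports "HOL-Analysis.Analysis"
begin

abbreviation unit_disc :: "complex set" where
  "unit_disc \<equiv> ball 0 1"

definition conformal_on :: "(complex \<Rightarrow> complex) \<Rightarrow> complex set \<Rightarrow> bool" (infixl "conformal'_on" 50)
  where "\<phi> conformal_on S \<longleftrightarrow> \<phi> holomorphic_on S \<and> inj_on \<phi> S"

(* Total variation, i.e. the supremum of the lengths of inscribed polygons; it is infinite for a
   non-rectifiable path. A partition is a sorted list of parameters, which need not contain 0 and 1:
   adding further points never decreases the sum. *)
definition path_length :: "(real \<Rightarrow> 'a::metric_space) \<Rightarrow> ereal" where
  "path_length \<gamma> =
     (SUP ts \<in> {ts. sorted ts \<and> set ts \<subseteq> {0..1}}.
        ereal (\<Sum>i<length ts - 1. dist (\<gamma> (ts ! i)) (\<gamma> (ts ! Suc i))))"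

definition linearly_connected :: "real \<Rightarrow> (complex \<Rightarrow> complex) \<Rightarrow> bool" where
  "linearly_connected c \<phi> \<longleftrightarrow>
     \<phi> conformal_on unit_disc \<and>
     (\<forall>z\<^sub>1\<in>unit_disc. \<forall>z\<^sub>2\<in>unit_disc. \<exists>\<gamma>.
        path \<gamma> \<and> path_image \<gamma> \<subseteq> \<phi> ` unit_disc \<and>
        pathstart \<gamma> = \<phi> z\<^sub>1 \<and> pathfinish \<gamma> = \<phi> z\<^sub>2 \<and>
        path_length \<gamma> \<le> ereal (c * cmod (\<phi> z\<^sub>1 - \<phi> z\<^sub>2)))"

end

theory Submission
  imports Defs "HOL-Complex_Analysis.Riemann_Mapping"
begin

text \<open>The function in question is an affine map after \<open>\<phi>\<close> after the disc
  automorphism T(z) = (z + a) / (1 + cnj a * z). Composing with T on the inside only relabels the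
  points of the image domain, so the same curves serve
  (\<open>linearly_connected_compose_disc\<close>). The affine map w |-> (w - b) / m is a
  similarity: it multiplies curve lengths and chords alike by 1 / |m|, so the ratio bounded by
  \<open>c\<close> does not change (\<open>linearly_connected_affine\<close>). The normalising
  factor is nonzero because an injective holomorphic function has no critical points and |a| <
  1.\<close>

lemma path_length_lipschitz_le:
  assumes "k-lipschitz_on S f" and "path_image \<gamma> \<subseteq> S"
  shows "path_length (f \<circ> \<gamma>) \<le> ereal k * path_length \<gamma>"
  unfolding path_length_def
proof (rule SUP_least, clarify)
  fix ts :: "real list"
  assume ts: "sorted ts" "set ts \<subseteq> {0..1}"
  let ?v = "\<lambda>g. \<Sum>i<length ts - 1. dist (g (ts ! i)) (g (ts ! Suc i))"
  have k: "0 \<le> k"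
    using assms(1) by (rule lipschitz_on_nonneg)
  have mem: "\<gamma> (ts ! i) \<in> S" if "i < length ts" for i
    using that ts(2) assms(2) nth_mem unfolding path_image_def by blast
  \<comment> \<open>For a fixed partition, every edge of the inscribed polygon is stretched by a
    factor of at most \<open>k\<close>; the supremum over partitions is taken only
    afterwards.\<close>
  have "?v (f \<circ> \<gamma>) \<le> (\<Sum>i<length ts - 1. k * dist (\<gamma> (ts ! i)) (\<gamma> (ts ! Suc i)))"
    by (intro sum_mono) (simp add: lipschitz_onD[OF assms(1)] mem)
  then have "ereal (?v (f \<circ> \<gamma>)) \<le> ereal k * ereal (?v \<gamma>)"
    by (simp add: sum_distrib_left)
  also have "\<dots> \<le> ereal k * (SUP ts \<in> {ts. sorted ts \<and> set ts \<subseteq> {0..1}}.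
        ereal (\<Sum>i<length ts - 1. dist (\<gamma> (ts ! i)) (\<gamma> (ts ! Suc i))))"
    \<comment> \<open>Multiplication by \<open>k\<close> is monotone on extended reals since
      \<open>k\<close> is nonnegative, so infinite length needs no separate case.\<close>
    using k ts by (intro ereal_mult_left_mono SUP_upper) auto
  finally show "ereal (?v (f \<circ> \<gamma>)) \<le> \<dots>" .
qed

text \<open>Since \<open>T\<close> permutes the disc, the image domain stays the same, and a curve
  for the pair T z1, T z2 under \<open>\<phi>\<close> is a curve for z1, z2 under the
  composite.\<close>

lemma linearly_connected_compose_disc:
  assumes "linearly_connected c \<phi>" and "T conformal_on unit_disc"
    and T: "T ` unit_disc = unit_disc"
  shows "linearly_connected c (\<phi> \<circ> T)"
  unfolding linearly_connected_def
proof (intro conjI ballI)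
  show "(\<phi> \<circ> T) conformal_on unit_disc"
    using assms unfolding linearly_connected_def conformal_on_def
    by (auto intro!: holomorphic_on_compose comp_inj_on)
next
  fix z\<^sub>1 z\<^sub>2 :: complex
  assume "z\<^sub>1 \<in> unit_disc" "z\<^sub>2 \<in> unit_disc"
  then have "T z\<^sub>1 \<in> unit_disc" "T z\<^sub>2 \<in> unit_disc"
    using T by blast+
  then show "\<exists>\<gamma>. path \<gamma> \<and> path_image \<gamma> \<subseteq> (\<phi> \<circ> T) ` unit_disc \<and>
      pathstart \<gamma> = (\<phi> \<circ> T) z\<^sub>1 \<and> pathfinish \<gamma> = (\<phi> \<circ> T) z\<^sub>2 \<and>
      path_length \<gamma> \<le> ereal (c * cmod ((\<phi> \<circ> T) z\<^sub>1 - (\<phi> \<circ> T) z\<^sub>2))"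
    using assms(1) unfolding linearly_connected_def image_comp[symmetric] T comp_apply by blast
qed

text \<open>Push the curve forward by the similarity; lengths and chords scale by the same
  factor.\<close>

lemma linearly_connected_affine:
  assumes "linearly_connected c \<phi>" and "m \<noteq> 0"
  shows "linearly_connected c (\<lambda>z. (\<phi> z - b) / m)"
  unfolding linearly_connected_def
proof (intro conjI ballI)
  show "(\<lambda>z. (\<phi> z - b) / m) conformal_on unit_disc"
    using assms unfolding linearly_connected_def conformal_on_def
    by (auto intro!: holomorphic_intros simp: inj_on_def)
next
  fix z\<^sub>1 z\<^sub>2 :: complex
  assume "z\<^sub>1 \<in> unit_disc" "z\<^sub>2 \<in> unit_disc"
  then obtain \<gamma> where \<gamma>: "path \<gamma>" "path_image \<gamma> \<subseteq> \<phi> ` unit_disc"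
      "pathstart \<gamma> = \<phi> z\<^sub>1" "pathfinish \<gamma> = \<phi> z\<^sub>2"
      "path_length \<gamma> \<le> ereal (c * cmod (\<phi> z\<^sub>1 - \<phi> z\<^sub>2))"
    using assms(1) unfolding linearly_connected_def by blast
  define f where "f w = (w - b) / m" for w
  have dist_f: "dist (f x) (f y) = 1 / cmod m * dist x y" for x y
    by (simp add: f_def dist_norm norm_divide flip: diff_divide_distrib)
  have "path (f \<circ> \<gamma>)"
    using assms(2) \<gamma>(1) by (auto intro!: path_continuous_image continuous_intros simp: f_def)
  moreover have "path_image (f \<circ> \<gamma>) \<subseteq> (\<lambda>z. (\<phi> z - b) / m) ` unit_disc"
    using \<gamma>(2) by (auto simp: path_image_compose f_def)
  moreover have "pathstart (f \<circ> \<gamma>) = (\<phi> z\<^sub>1 - b) / m" "pathfinish (f \<circ> \<gamma>) = (\<phi> z\<^sub>2 - b) / m"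
    using \<gamma>(3,4) by (simp_all add: pathstart_compose pathfinish_compose f_def)
  moreover have "path_length (f \<circ> \<gamma>) \<le> ereal (c * cmod ((\<phi> z\<^sub>1 - b) / m - (\<phi> z\<^sub>2 - b) / m))"
  proof -
    have "(1 / cmod m)-lipschitz_on UNIV f"
      by (rule lipschitz_onI) (simp_all only: dist_f, simp_all)
    then have "path_length (f \<circ> \<gamma>) \<le> ereal (1 / cmod m) * path_length \<gamma>"
      by (rule path_length_lipschitz_le) simp
    also have "\<dots> \<le> ereal (1 / cmod m) * ereal (c * cmod (\<phi> z\<^sub>1 - \<phi> z\<^sub>2))"
      using \<gamma>(5) by (intro ereal_mult_left_mono) auto
    \<comment> \<open>The Lipschitz bound alone would not do here: \<open>dist_f\<close> is an
      equality, so 1 / |m| is absorbed exactly into the new chord and the constant remains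
      \<open>c\<close>.\<close>
    also have "\<dots> = ereal (c * dist (f (\<phi> z\<^sub>1)) (f (\<phi> z\<^sub>2)))"
      by (simp add: dist_f flip: dist_norm)
    finally show ?thesis
      by (simp add: f_def dist_norm)
  qed
  ultimately show "\<exists>\<gamma>. path \<gamma> \<and> path_image \<gamma> \<subseteq> (\<lambda>z. (\<phi> z - b) / m) ` unit_disc \<and>
      pathstart \<gamma> = (\<phi> z\<^sub>1 - b) / m \<and> pathfinish \<gamma> = (\<phi> z\<^sub>2 - b) / m \<and>
      path_length \<gamma> \<le> ereal (c * cmod ((\<phi> z\<^sub>1 - b) / m - (\<phi> z\<^sub>2 - b) / m))"
    by blast
qed

text \<open>The inverse is again a Moebius function, with parameter \<open>- w\<close>.\<close>

lemma Moebius_function_bij_betw_disc: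
  assumes "cmod w < 1"
  shows "bij_betw (Moebius_function 0 w) unit_disc unit_disc"
  using assms
  by (intro bij_betw_byWitness[where f' = "Moebius_function 0 (- w)"])
     (auto simp: Moebius_function_compose Moebius_function_norm_lt_1)

theorem theorem6:
  fixes \<phi> :: "complex \<Rightarrow> complex" and c :: real and a :: complex
  assumes "1 \<le> c"
    and "\<phi> conformal_on unit_disc"
    and "linearly_connected c \<phi>"
    and "a \<in> unit_disc"
  shows "linearly_connected c
           (\<lambda>z. (\<phi> ((z + a) / (1 + cnj a * z)) - \<phi> a) /
                (of_real (1 - (cmod a)\<^sup>2) * deriv \<phi> a))"
proof -
  \<comment> \<open>\<open>Moebius_function 0 w\<close> is (z - w) / (1 - cnj w * z), so the
    parameter \<open>- a\<close> yields the required automorphism, which sends 0 to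
    \<open>a\<close>.\<close>
  let ?T = "Moebius_function 0 (- a)"
  have a: "cmod a < 1"
    using assms(4) by simp
  have "bij_betw ?T unit_disc unit_disc"
    using a by (simp add: Moebius_function_bij_betw_disc)
  then have "?T conformal_on unit_disc" "?T ` unit_disc = unit_disc"
    using a by (simp_all add: conformal_on_def bij_betw_def Moebius_function_holomorphic)
  then have "linearly_connected c (\<phi> \<circ> ?T)"
    by (rule linearly_connected_compose_disc[OF assms(3)])
  moreover have "of_real (1 - (cmod a)\<^sup>2) * deriv \<phi> a \<noteq> 0"
  proof -
    \<comment> \<open>Injectivity on an open set rules out a zero of the derivative.\<close>
    have "deriv \<phi> a \<noteq> 0"
      using assms(2,4) unfolding conformal_on_def
      by (meson holomorphic_injective_imp_regular open_ball)
    moreover have "(cmod a)\<^sup>2 \<noteq> 1"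
      using a power2_eq_1_iff[of "cmod a"] norm_ge_zero[of a] by linarith
    ultimately show ?thesis
      by (simp flip: of_real_diff of_real_power)
  qed
  ultimately have "linearly_connected c (\<lambda>z. ((\<phi> \<circ> ?T) z - \<phi> a) /
      (of_real (1 - (cmod a)\<^sup>2) * deriv \<phi> a))"
    by (rule linearly_connected_affine)
  then show ?thesis
    by (simp add: Moebius_function_simple)
qed

end
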